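(* Let $k\geq2$ and $N\geq2$. Let $P$ be the one-vertex $k$-cube complex of a residually finite $k$-cube group $G$, let $H$ be a normal subgroup of $G$ of index $N$, and let $p:\tilde{P}\to P$ be the corresponding $N$-cover, with $\mathcal{X}=\tilde{P}$ the associated $k$-cube complex with $N$ vertices. The following are valid. (a) The $k$-dimensional digraph $\mathrm{DG}(\mathcal{X})$ is left and right rigid. (b) The $k$-graph $\Lambda(\mathcal{X})=\Lambda_{\mathrm{DG}(\mathcal{X})}$ associated to $\mathrm{DG}(\mathcal{X})$ is strongly connected, left rigid and right rigid.
   Context: A $k$-cube structure in a group $G$ is an ordered $k$-tuple $(A_1,\dots,A_k)$ of finite subsets such that for all $i\ne j$: (1) taking inverses induces fixed point free involutions on $A_i$; (2) $\bigcup A_i$ generates $G$; (3) $A_iA_j$ and $A_jA_i$ have size $\#A_i\cdot\#A_j$ and $A_iA_j=A_jA_i$; (4) $A_iA_j$ contains no $2$-torsion; (5) $G$ acts simply transitively on (the vertices of) a Cartesian product of $k$ trees. Then $G$ is a $k$-cube group; its one-vertex $k$-cube complex $P$ is the quotient of the product of trees by $G$, with oriented edges of colour $i$ labelled by $A_i$ and geometric squares given by the relations $ab=b'a'$ in $G$ ($a,a'\in A_i$, $b,b'\in A_j$, $i\ne j$); $\pi_1(P)=G$. The $N$-cover $\mathcal{X}$ associated to $H$ is the covering complex of $P$ corresponding to the normal subgroup $H\le G$; its $N$ vertices are identified with the elements of $G/H$, on which the generators act by translation via Cayley's theorem $G/H\hookrightarrow S_N$, and its edges inherit colours from $P$. $\mathrm{DG}(\mathcal{X})$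 has as vertices those of $\mathcal{X}$, and edges $E=E_1\sqcup\dots\sqcup E_k$ with $E_i$ the set of oriented edges of $\mathcal{X}$ of colour $i$ (each geometric edge gives two oppositely oriented edges), with origin and terminus maps $o,t$. For a path $xy$ ($t(x)=o(y)$) with $x\in E_i$, $y\in E_j$, $i\neq j$, write $xy\sim y'x'$, where $y'x'$ ($y'\in E_j$, $x'\in E_i$) is the other boundary path with same origin and terminus in the unique geometric square having $xy$ as two consecutive boundary edges. $\Lambda(\mathcal{X})$ is the quotient of the free category on this directed graph (the path $x_1\cdots x_m$ being the morphism $x_m\circ\cdots\circ x_1$) by the congruence generated by $xy\sim y'x'$, with degree functor $d$ to $\mathbb{N}^k$ sending $E_i$ to $e_i$; it is a $k$-graph with $d^{-1}(e_i)=E_i$. $\mathrm{DG}$ is right rigid if for $x\in E_i$, $y\in E_j$, $i\neq j$, with $o(x)=o(y)$, there are unique $x'\in E_i$, $y'\in E_j$ with $xy'\sim yx'$; it is left rigid if for $x'\in E_i$, $y'\in E_j$, $i\ne j$, with $t(x')=t(y')$, there are unique $x\in E_i$, $y\in E_j$ with $xy'\sim yx'$. A $k$-graph with alphabets $E_i=d^{-1}(\{e_i\})$ is right rigid if for $x\in E_i$, $y\in E_j$, $i\ne j$, with the same origin, there are unique $x'\in E_i$, $y'\in E_j$ with $y'\circ x=x'\circ y$; left rigid if for $x'\in E_i$, $y'\in E_j$, $i\ne j$, with the same terminus, there are unique $x\in E_i$, $y\in E_j$ with $y'\circ x=x'\circ y$. A finite $k$-graph $\Lambda$ is strongly connected if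 for all vertices $v,w$ there is a morphism in $\Lambda$ with range $v$ and source $w$. *)

theory Defs
  imports
    "HOL-Algebra.Group_Action"
    "HOL-Algebra.Generated_Groups"
    "Graph_Theory.Arc_Walk"
begin

section \<open>Groups acting on products of trees\<close>

definition residually_finite :: "('g, 'z) monoid_scheme \<Rightarrow> bool" where
  "residually_finite G \<longleftrightarrow>
     (\<forall>g \<in> carrier G. g \<noteq> \<one>\<^bsub>G\<^esub> \<longrightarrow>
        (\<exists>K. K \<lhd> G \<and> finite (carrier (G Mod K)) \<and> g \<notin> K))"

text \<open>Trees may be infinite. An undirected edge is a symmetric pair of elements of \<open>E\<close>.
  The constant \<open>tree\<close> of Graph\_Theory is not used because its acyclicity condition only
  excludes directed cycles (and rejects every symmetric digraph with an edge).\<close>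

definition tree_graph :: "'v set \<Rightarrow> 'v rel \<Rightarrow> bool" where
  "tree_graph V E \<longleftrightarrow>
     V \<noteq> {} \<and> E \<subseteq> V \<times> V \<and> sym E \<and> irrefl E \<and>
     (\<forall>u \<in> V. \<forall>v \<in> V. (u, v) \<in> E\<^sup>*) \<and>
     \<not> (\<exists>c. length c \<ge> 3 \<and> distinct c \<and> successively (\<lambda>u v. (u, v) \<in> E) c \<and>
           (last c, hd c) \<in> E)"

definition product_vertices :: "nat \<Rightarrow> (nat \<Rightarrow> 'v set) \<Rightarrow> (nat \<Rightarrow> 'v) set" where
  "product_vertices k V = (\<Pi>\<^sub>E i \<in> {..<k}. V i)"

definition product_adj :: "nat \<Rightarrow> (nat \<Rightarrow> 'v rel) \<Rightarrow> (nat \<Rightarrow> 'v) \<Rightarrow> (nat \<Rightarrow> 'v) \<Rightarrow> bool" where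
  "product_adj k E x y \<longleftrightarrow>
     (\<exists>i < k. (x i, y i) \<in> E i \<and> (\<forall>j < k. j \<noteq> i \<longrightarrow> x j = y j))"

text \<open>An automorphism of a product of trees, as a cube complex, is the same thing as an
  automorphism of its 1-skeleton, because the cubes are determined by the 1-skeleton.\<close>

definition simply_transitive_on_trees ::
  "('g, 'z) monoid_scheme \<Rightarrow> nat \<Rightarrow> (nat \<Rightarrow> 'v set) \<Rightarrow> (nat \<Rightarrow> 'v rel) \<Rightarrow>
     ('g \<Rightarrow> (nat \<Rightarrow> 'v) \<Rightarrow> (nat \<Rightarrow> 'v)) \<Rightarrow> bool" where
  "simply_transitive_on_trees G k V E \<phi> \<longleftrightarrow>
     (\<forall>i < k. tree_graph (V i) (E i)) \<and>
     group_action G (product_vertices k V) \<phi> \<and>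
     (\<forall>g \<in> carrier G. \<forall>x \<in> product_vertices k V. \<forall>y \<in> product_vertices k V.
        product_adj k E x y \<longleftrightarrow> product_adj k E (\<phi> g x) (\<phi> g y)) \<and>
     (\<forall>x \<in> product_vertices k V. \<forall>y \<in> product_vertices k V.
        \<exists>!g. g \<in> carrier G \<and> \<phi> g x = y)"

text \<open>The tuple \<open>(A\<^sub>1, \<dots>, A\<^sub>k)\<close> is indexed by \<open>{..<k}\<close>.\<close>

definition k_cube_structure ::
  "('g, 'z) monoid_scheme \<Rightarrow> nat \<Rightarrow> (nat \<Rightarrow> 'g set) \<Rightarrow> (nat \<Rightarrow> 'v set) \<Rightarrow> (nat \<Rightarrow> 'v rel) \<Rightarrow>
     ('g \<Rightarrow> (nat \<Rightarrow> 'v) \<Rightarrow> (nat \<Rightarrow> 'v)) \<Rightarrow> bool" where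
  "k_cube_structure G k A V E \<phi> \<longleftrightarrow>
     group G \<and>
     (\<forall>i < k. finite (A i) \<and> A i \<subseteq> carrier G) \<and>
     (\<forall>i < k. \<forall>a \<in> A i. inv\<^bsub>G\<^esub> a \<in> A i \<and> inv\<^bsub>G\<^esub> a \<noteq> a) \<and>
     generate G (\<Union>i<k. A i) = carrier G \<and>
     (\<forall>i < k. \<forall>j < k. i \<noteq> j \<longrightarrow>
        card (A i <#>\<^bsub>G\<^esub> A j) = card (A i) * card (A j) \<and>
        card (A j <#>\<^bsub>G\<^esub> A i) = card (A i) * card (A j) \<and>
        A i <#>\<^bsub>G\<^esub> A j = A j <#>\<^bsub>G\<^esub> A i) \<and>
     (\<forall>i < k. \<forall>j < k. i \<noteq> j \<longrightarrow>
        \<not> (\<exists>g \<in> A i <#>\<^bsub>G\<^esub> A j. g \<noteq> \<one>\<^bsub>G\<^esub> \<and> g \<otimes>\<^bsub>G\<^esub> g = \<one>\<^bsub>G\<^esub>)) \<and>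
     simply_transitive_on_trees G k V E \<phi>"

section \<open>The one-vertex complex and its covers\<close>

text \<open>The 2-skeleton of a cube complex with coloured edges; higher cubes play no role in
  the digraph or the \<open>k\<close>-graph of the complex. The arcs of \<open>skel\<close> are the oriented
  edges, \<open>tail\<close> and \<open>head\<close> are origin and terminus, and \<open>opp\<close> reverses the orientation.
  A quadruple \<open>(x, y, y', x')\<close> in \<open>squares\<close> is a geometric square read from one of its
  corners: \<open>xy\<close> and \<open>y'x'\<close> are its two boundary paths to the opposite corner. Every
  geometric square contributes all its readings (any corner, either path first).\<close>

record ('v, 'e) square_complex =
  skel :: "('v, 'e) pre_digraph"
  colour :: "'e \<Rightarrow> nat"
  opp :: "'e \<Rightarrow> 'e"
  squares :: "('e \<times> 'e \<times> 'e \<times> 'e) set"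

text \<open>The oriented edge of colour \<open>i\<close> labelled by \<open>a \<in> A\<^sub>i\<close> is the pair \<open>(i, a)\<close>.\<close>

definition one_vertex_complex ::
  "('g, 'z) monoid_scheme \<Rightarrow> nat \<Rightarrow> (nat \<Rightarrow> 'g set) \<Rightarrow> (unit, nat \<times> 'g) square_complex" where
  "one_vertex_complex G k A =
     \<lparr> skel = \<lparr> verts = {()}, arcs = (SIGMA i : {..<k}. A i),
                tail = (\<lambda>_. ()), head = (\<lambda>_. ()) \<rparr>,
       colour = fst,
       opp = (\<lambda>(i, a). (i, inv\<^bsub>G\<^esub> a)),
       squares = {((i, a), (j, b), (j, b'), (i, a')) | i j a b b' a'.
          i < k \<and> j < k \<and> i \<noteq> j \<and> a \<in> A i \<and> a' \<in> A i \<and> b \<in> A j \<and> b' \<in> A j \<and>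
          a \<otimes>\<^bsub>G\<^esub> b = b' \<otimes>\<^bsub>G\<^esub> a'} \<rparr>"

text \<open>The cover of a one-vertex complex \<open>P\<close>, whose fundamental group is \<open>G\<close> with the edge
  \<open>(i, a)\<close> representing \<open>a\<close>, corresponding to a normal subgroup \<open>H\<close>. Its vertices are the
  elements of \<open>G/H\<close>. The lift of the loop \<open>(i, a)\<close> at \<open>v\<close> is \<open>(v, i, a)\<close>; it ends in the
  translate of \<open>v\<close> by \<open>a\<close>. Translation is on the right, so that a path with labels
  \<open>a\<^sub>1, \<dots>, a\<^sub>m\<close> leads from \<open>v\<close> to \<open>v a\<^sub>1 \<dots> a\<^sub>m\<close>, in accordance with the relations
  \<open>ab = b'a'\<close>. The squares are the lifts of the squares of \<open>P\<close>.\<close>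

definition covering_complex ::
  "('g, 'z) monoid_scheme \<Rightarrow> 'g set \<Rightarrow> (unit, nat \<times> 'g) square_complex \<Rightarrow>
     ('g set, 'g set \<times> nat \<times> 'g) square_complex" where
  "covering_complex G H P =
     (let org = (\<lambda>(v, i, a). v);
          ter = (\<lambda>(v, i, a). v \<otimes>\<^bsub>G Mod H\<^esub> (H #>\<^bsub>G\<^esub> a));
          edges = carrier (G Mod H) \<times> arcs (skel P)
      in \<lparr> skel = \<lparr> verts = carrier (G Mod H), arcs = edges, tail = org, head = ter \<rparr>,
           colour = (\<lambda>(v, e). colour P e),
           opp = (\<lambda>(v, e). (ter (v, e), opp P e)),
           squares = {(x, y, y', x').
              {x, y, y', x'} \<subseteq> edges \<and>
              (snd x, snd y, snd y', snd x') \<in> squares P \<and>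
              org y' = org x \<and> org y = ter x \<and> org x' = ter y' \<and> ter x' = ter y} \<rparr>)"

subsection \<open>The covering property\<close>

text \<open>Sanity checks on \<open>covering_complex\<close>: the projection to \<open>P\<close> is a covering, that is,
  edges and squares lift uniquely at every vertex, and a path lifts to a closed path iff the
  element of \<open>G\<close> it represents lies in \<open>H\<close>.\<close>

definition squares_at :: "('v, 'e) square_complex \<Rightarrow> 'v \<Rightarrow> ('e \<times> 'e \<times> 'e \<times> 'e) set" where
  "squares_at X v = {(x, y, y', x') \<in> squares X. tail (skel X) x = v}"

definition covering_map ::
  "('v, 'e) square_complex \<Rightarrow> ('w, 'f) square_complex \<Rightarrow> ('v \<Rightarrow> 'w) \<Rightarrow> ('e \<Rightarrow> 'f) \<Rightarrow> bool" where
  "covering_map X P pv pe \<longleftrightarrow>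
     pv ` verts (skel X) = verts (skel P) \<and>
     (\<forall>e \<in> arcs (skel X). pe e \<in> arcs (skel P) \<and> colour P (pe e) = colour X e \<and>
        opp P (pe e) = pe (opp X e) \<and>
        tail (skel P) (pe e) = pv (tail (skel X) e) \<and>
        head (skel P) (pe e) = pv (head (skel X) e)) \<and>
     (\<forall>v \<in> verts (skel X).
        bij_betw pe {e \<in> arcs (skel X). tail (skel X) e = v}
          {e \<in> arcs (skel P). tail (skel P) e = pv v} \<and>
        bij_betw (\<lambda>(x, y, y', x'). (pe x, pe y, pe y', pe x'))
          (squares_at X v) (squares_at P (pv v)))"

definition path_value :: "('g, 'z) monoid_scheme \<Rightarrow> ('w \<times> nat \<times> 'g) list \<Rightarrow> 'g" where
  "path_value G p = foldr (\<lambda>(v, i, a) g. a \<otimes>\<^bsub>G\<^esub> g) p \<one>\<^bsub>G\<^esub>"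

context
  fixes G :: "('g, 'z) monoid_scheme" (structure) and k A H P X
  assumes G: "group G"
    and A: "\<And>i. i < k \<Longrightarrow> A i \<subseteq> carrier G"
    and H: "H \<lhd> G"
    and P: "P = one_vertex_complex G k A"
    and X: "X = covering_complex G H P"
begin

lemma coset_translate:
  assumes "v \<in> carrier (G Mod H)" "a \<in> carrier G" "b \<in> carrier G"
  shows "v \<otimes>\<^bsub>G Mod H\<^esub> (H #> a) \<in> carrier (G Mod H)"
    and "(v \<otimes>\<^bsub>G Mod H\<^esub> (H #> a)) \<otimes>\<^bsub>G Mod H\<^esub> (H #> b) = v \<otimes>\<^bsub>G Mod H\<^esub> (H #> (a \<otimes> b))"
proof -
  interpret normal H G by (rule H)
  interpret Q: group "G Mod H" by (rule factorgroup_is_group)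
  have c: "H #> c \<in> carrier (G Mod H)" if "c \<in> carrier G" for c
    using that by (auto simp: FactGroup_def RCOSETS_def)
  show "v \<otimes>\<^bsub>G Mod H\<^esub> (H #> a) \<in> carrier (G Mod H)"
    using assms c by (intro Q.m_closed) auto
  have "(H #> a) \<otimes>\<^bsub>G Mod H\<^esub> (H #> b) = H #> (a \<otimes> b)"
    using assms by (simp add: FactGroup_def rcos_sum)
  then show "(v \<otimes>\<^bsub>G Mod H\<^esub> (H #> a)) \<otimes>\<^bsub>G Mod H\<^esub> (H #> b) = v \<otimes>\<^bsub>G Mod H\<^esub> (H #> (a \<otimes> b))"
    using assms c by (metis Q.m_assoc)
qed

lemma covering_complex_covering: "covering_map X P (\<lambda>_. ()) snd"
proof -
  interpret normal H G by (rule H)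
  interpret Q: group "G Mod H" by (rule factorgroup_is_group)
  have sq: "bij_betw (\<lambda>(x, y, y', x'). (snd x, snd y, snd y', snd x'))
          (squares_at X v) (squares_at P ())" if v: "v \<in> carrier (G Mod H)" for v
  proof (rule bij_betw_imageI)
    show "inj_on (\<lambda>(x, y, y', x'). (snd x, snd y, snd y', snd x')) (squares_at X v)"
      by (auto simp: inj_on_def squares_at_def X covering_complex_def Let_def)
    show "(\<lambda>(x, y, y', x'). (snd x, snd y, snd y', snd x')) ` squares_at X v = squares_at P ()"
    proof (intro equalityI subsetI)
      fix s assume "s \<in> (\<lambda>(x, y, y', x'). (snd x, snd y, snd y', snd x')) ` squares_at X v"
      then show "s \<in> squares_at P ()"
        by (auto simp: squares_at_def X covering_complex_def Let_def)
    next
      fix s assume s: "s \<in> squares_at P ()"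
      then obtain i j a b b' a' where ab: "s = ((i, a), (j, b), (j, b'), (i, a'))"
        "i < k" "j < k" "i \<noteq> j" "a \<in> A i" "a' \<in> A i" "b \<in> A j" "b' \<in> A j" "a \<otimes> b = b' \<otimes> a'"
        by (auto simp: squares_at_def P one_vertex_complex_def)
      have car: "a \<in> carrier G" "b \<in> carrier G" "a' \<in> carrier G" "b' \<in> carrier G"
        using ab A by blast+
      let ?t = "\<lambda>a. v \<otimes>\<^bsub>G Mod H\<^esub> (H #> a)"
      have "((v, i, a), (?t a, j, b), (v, j, b'), (?t b', i, a')) \<in> squares_at X v"
        using ab car v coset_translate
        by (auto simp: squares_at_def X covering_complex_def Let_def P one_vertex_complex_def)
      then show "s \<in> (\<lambda>(x, y, y', x'). (snd x, snd y, snd y', snd x')) ` squares_at X v"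
        using ab(1) by force
    qed
  qed
  have "carrier (G Mod H) \<noteq> {}" using Q.one_closed by blast
  moreover have "bij_betw snd {e \<in> arcs (skel X). tail (skel X) e = v}
          {e \<in> arcs (skel P). tail (skel P) e = ()}" if "v \<in> carrier (G Mod H)" for v
    using that by (auto simp: bij_betw_def inj_on_def X covering_complex_def Let_def image_iff)
  ultimately show ?thesis
    using sq unfolding covering_map_def
    by (auto simp: X covering_complex_def Let_def P one_vertex_complex_def)
qed

lemma covering_complex_lift:
  assumes "pre_digraph.awalk (skel X) v p w"
  shows "path_value G p \<in> carrier G \<and> w = v \<otimes>\<^bsub>G Mod H\<^esub> (H #> path_value G p)"
proof -
  interpret normal H G by (rule H)
  interpret Q: group "G Mod H" by (rule factorgroup_is_group)
  show ?thesis using assms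
  proof (induction p arbitrary: v)
    case Nil
    have "H #> \<one> = \<one>\<^bsub>G Mod H\<^esub>" by (simp add: FactGroup_def coset_mult_one subset)
    moreover have "v \<in> carrier (G Mod H)" "w = v" using Nil
      by (auto simp: pre_digraph.awalk_def pre_digraph.cas.simps X covering_complex_def Let_def)
    ultimately show ?case by (simp add: path_value_def del: mult_FactGroup one_FactGroup)
  next
    case (Cons e p)
    obtain u i a where e: "e = (u, i, a)" by (cases e)
    have **: "u = v" "v \<in> carrier (G Mod H)" "i < k" "a \<in> A i"
      using Cons.prems
      by (auto simp: pre_digraph.awalk_def pre_digraph.cas.simps X covering_complex_def Let_def
          e P one_vertex_complex_def)
    then have a: "a \<in> carrier G" using A by blast
    have *: "u = v" "v \<in> carrier (G Mod H)" "i < k" "a \<in> A i"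
      "pre_digraph.awalk (skel X) (v \<otimes>\<^bsub>G Mod H\<^esub> (H #> a)) p w"
      using Cons.prems coset_translate(1)[OF **(2) a a] **
      by (auto simp: pre_digraph.awalk_def pre_digraph.cas.simps X covering_complex_def Let_def
          e P one_vertex_complex_def)
    show ?case using Cons.IH[OF *(5)] a * coset_translate(2)
      by (auto simp: path_value_def e)
  qed
qed

lemma covering_complex_closed_lift_iff:
  assumes "pre_digraph.awalk (skel X) v p w"
  shows "w = v \<longleftrightarrow> path_value G p \<in> H"
proof -
  interpret normal H G by (rule H)
  interpret Q: group "G Mod H" by (rule factorgroup_is_group)
  note l = covering_complex_lift[OF assms]
  have v: "v \<in> carrier (G Mod H)"
    using assms by (auto simp: pre_digraph.awalk_def X covering_complex_def Let_def)
  have c: "H #> path_value G p \<in> carrier (G Mod H)"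
    using l by (auto simp: FactGroup_def RCOSETS_def)
  have "w = v \<longleftrightarrow> H #> path_value G p = \<one>\<^bsub>G Mod H\<^esub>"
    using l Q.l_cancel_one[OF v c] by simp
  also have "\<dots> \<longleftrightarrow> path_value G p \<in> H"
    using l coset_join1[OF _ _ is_subgroup] coset_join2[OF _ is_subgroup] subset
    by (auto simp: FactGroup_def)
  finally show ?thesis .
qed

end

section \<open>Digraphs of cube complexes\<close>

text \<open>\<open>((x, y), (y', x')) \<in> sim D\<close> stands for \<open>xy \<sim> y'x'\<close>.\<close>

record ('v, 'e) kdigraph =
  dgraph :: "('v, 'e) pre_digraph"
  ecolour :: "'e \<Rightarrow> nat"
  sim :: "(('e \<times> 'e) \<times> ('e \<times> 'e)) set"

definition DG :: "('v, 'e) square_complex \<Rightarrow> ('v, 'e) kdigraph" where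
  "DG X = \<lparr> dgraph = skel X, ecolour = colour X,
            sim = {((x, y), (y', x')) | x y y' x'. (x, y, y', x') \<in> squares X} \<rparr>"

definition colour_arcs :: "('v, 'e) kdigraph \<Rightarrow> nat \<Rightarrow> 'e set" where
  "colour_arcs D i = {e \<in> arcs (dgraph D). ecolour D e = i}"

definition DG_right_rigid :: "nat \<Rightarrow> ('v, 'e) kdigraph \<Rightarrow> bool" where
  "DG_right_rigid k D \<longleftrightarrow>
     (\<forall>i < k. \<forall>j < k. i \<noteq> j \<longrightarrow>
        (\<forall>x \<in> colour_arcs D i. \<forall>y \<in> colour_arcs D j. tail (dgraph D) x = tail (dgraph D) y \<longrightarrow>
           (\<exists>!q. q \<in> colour_arcs D i \<times> colour_arcs D j \<and>
                 (case q of (x', y') \<Rightarrow> ((x, y'), (y, x')) \<in> sim D))))"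

definition DG_left_rigid :: "nat \<Rightarrow> ('v, 'e) kdigraph \<Rightarrow> bool" where
  "DG_left_rigid k D \<longleftrightarrow>
     (\<forall>i < k. \<forall>j < k. i \<noteq> j \<longrightarrow>
        (\<forall>x' \<in> colour_arcs D i. \<forall>y' \<in> colour_arcs D j.
           head (dgraph D) x' = head (dgraph D) y' \<longrightarrow>
           (\<exists>!q. q \<in> colour_arcs D i \<times> colour_arcs D j \<and>
                 (case q of (x, y) \<Rightarrow> ((x, y'), (y, x')) \<in> sim D))))"

section \<open>The k-graph of a digraph\<close>

text \<open>The data of a small category with a degree map to \<open>\<nat>\<^sup>k\<close>; an element of \<open>\<nat>\<^sup>k\<close> is a
  function \<open>nat \<Rightarrow> nat\<close> vanishing outside \<open>{..<k}\<close>. \<open>Src\<close> and \<open>Rng\<close> are source (origin)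
  and range (terminus), and \<open>Comp g f\<close> is \<open>g \<circ> f\<close>, meaningful if \<open>Src g = Rng f\<close>.\<close>

record ('o, 'm) graded_category =
  Obj :: "'o set"
  Mor :: "'m set"
  Src :: "'m \<Rightarrow> 'o"
  Rng :: "'m \<Rightarrow> 'o"
  Id :: "'o \<Rightarrow> 'm"
  Comp :: "'m \<Rightarrow> 'm \<Rightarrow> 'm"
  Deg :: "'m \<Rightarrow> nat \<Rightarrow> nat"

text \<open>The free category on a digraph: the path with edges \<open>p\<close> from \<open>u\<close> to \<open>v\<close> is \<open>(u, p, v)\<close>.\<close>

type_synonym ('v, 'e) path = "'v \<times> 'e list \<times> 'v"

definition paths :: "('v, 'e) kdigraph \<Rightarrow> ('v, 'e) path set" where
  "paths D = {(u, p, v). pre_digraph.awalk (dgraph D) u p v}"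

definition path_src :: "('v, 'e) path \<Rightarrow> 'v" where
  "path_src = (\<lambda>(u, p, v). u)"

definition path_rng :: "('v, 'e) path \<Rightarrow> 'v" where
  "path_rng = (\<lambda>(u, p, v). v)"

definition path_comp :: "('v, 'e) path \<Rightarrow> ('v, 'e) path \<Rightarrow> ('v, 'e) path" where
  "path_comp = (\<lambda>(v', q, w) (u, p, v). (u, p @ q, w))"

definition path_deg :: "('v, 'e) kdigraph \<Rightarrow> ('v, 'e) path \<Rightarrow> nat \<Rightarrow> nat" where
  "path_deg D = (\<lambda>(u, p, v) i. length (filter (\<lambda>e. ecolour D e = i) p))"

text \<open>The congruence on the free category generated by \<open>\<sim>\<close>.\<close>

inductive_set path_cong :: "('v, 'e) kdigraph \<Rightarrow> ('v, 'e) path rel"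
  for D :: "('v, 'e) kdigraph" where
  gen: "((x, y), (y', x')) \<in> sim D \<Longrightarrow> (u, [x, y], v) \<in> paths D \<Longrightarrow> (u, [y', x'], v) \<in> paths D \<Longrightarrow>
          ((u, [x, y], v), (u, [y', x'], v)) \<in> path_cong D"
| refl: "f \<in> paths D \<Longrightarrow> (f, f) \<in> path_cong D"
| sym: "(f, g) \<in> path_cong D \<Longrightarrow> (g, f) \<in> path_cong D"
| trans: "(f, g) \<in> path_cong D \<Longrightarrow> (g, h) \<in> path_cong D \<Longrightarrow> (f, h) \<in> path_cong D"
| comp: "(f, f') \<in> path_cong D \<Longrightarrow> (g, g') \<in> path_cong D \<Longrightarrow> path_src g = path_rng f \<Longrightarrow>
          (path_comp g f, path_comp g' f') \<in> path_cong D"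

definition Lambda :: "('v, 'e) kdigraph \<Rightarrow> ('v, ('v, 'e) path set) graded_category" where
  "Lambda D =
     \<lparr> Obj = verts (dgraph D),
       Mor = paths D // path_cong D,
       Src = (\<lambda>C. the_elem (path_src ` C)),
       Rng = (\<lambda>C. the_elem (path_rng ` C)),
       Id = (\<lambda>v. path_cong D `` {(v, [], v)}),
       Comp = (\<lambda>C' C. \<Union>g \<in> C'. \<Union>f \<in> C. path_cong D `` {path_comp g f}),
       Deg = (\<lambda>C. the_elem (path_deg D ` C)) \<rparr>"

definition unit_deg :: "nat \<Rightarrow> nat \<Rightarrow> nat" where
  "unit_deg i = (\<lambda>j. if j = i then 1 else 0)"

definition alphabet :: "('o, 'm) graded_category \<Rightarrow> nat \<Rightarrow> 'm set" where
  "alphabet L i = {f \<in> Mor L. Deg L f = unit_deg i}"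

text \<open>\<open>commuting_square L x y' y x'\<close>: both composites \<open>y' \<circ> x\<close> and \<open>x' \<circ> y\<close> are defined and
  they are equal.\<close>

definition commuting_square ::
  "('o, 'm) graded_category \<Rightarrow> 'm \<Rightarrow> 'm \<Rightarrow> 'm \<Rightarrow> 'm \<Rightarrow> bool" where
  "commuting_square L x y' y x' \<longleftrightarrow>
     Src L y' = Rng L x \<and> Src L x' = Rng L y \<and> Comp L y' x = Comp L x' y"

definition kgraph_right_rigid :: "nat \<Rightarrow> ('o, 'm) graded_category \<Rightarrow> bool" where
  "kgraph_right_rigid k L \<longleftrightarrow>
     (\<forall>i < k. \<forall>j < k. i \<noteq> j \<longrightarrow>
        (\<forall>x \<in> alphabet L i. \<forall>y \<in> alphabet L j. Src L x = Src L y \<longrightarrow>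
           (\<exists>!q. q \<in> alphabet L i \<times> alphabet L j \<and>
                 (case q of (x', y') \<Rightarrow> commuting_square L x y' y x'))))"

definition kgraph_left_rigid :: "nat \<Rightarrow> ('o, 'm) graded_category \<Rightarrow> bool" where
  "kgraph_left_rigid k L \<longleftrightarrow>
     (\<forall>i < k. \<forall>j < k. i \<noteq> j \<longrightarrow>
        (\<forall>x' \<in> alphabet L i. \<forall>y' \<in> alphabet L j. Rng L x' = Rng L y' \<longrightarrow>
           (\<exists>!q. q \<in> alphabet L i \<times> alphabet L j \<and>
                 (case q of (x, y) \<Rightarrow> commuting_square L x y' y x'))))"

definition kgraph_strongly_connected :: "('o, 'm) graded_category \<Rightarrow> bool" where
  "kgraph_strongly_connected L \<longleftrightarrow>
     (\<forall>v \<in> Obj L. \<forall>w \<in> Obj L. \<exists>f \<in> Mor L. Rng L f = v \<and> Src L f = w)"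

end

theory Submission
  imports Defs
begin

text \<open>
  Since \<open>#(A\<^sub>iA\<^sub>j) = #A\<^sub>i #A\<^sub>j\<close>, factorisations in \<open>A\<^sub>iA\<^sub>j = A\<^sub>jA\<^sub>i\<close> are unique, so rewriting
  \<open>ab' = ba'\<close> as \<open>b\<^sup>-\<^sup>1a = a'b'\<^sup>-\<^sup>1\<close> gives rigidity of the digraph. The same uniqueness shows
  that the relation \<open>\<sim>\<close> is already transitive up to equality, so the congruence it generates is
  trivial on edges and relates two paths of length 2 only if they are equal or bound a square.
  Hence the alphabets of the \<open>k\<close>-graph are the sets of coloured edges, and rigidity transfers.
\<close>

section \<open>From digraphs to k-graphs\<close>

lemma image_eq_singleton:
  assumes "x \<in> C" "\<And>y. y \<in> C \<Longrightarrow> h y = c"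
  shows "h ` C = {c}"
  using assms by (auto simp: image_iff intro!: bexI[of _ x])

text \<open>Transports the unique existence in rigidity from pairs of edges to pairs of morphisms;
  \<open>f\<close> will be the map sending an edge to its class.\<close>

lemma ex1_pair_image:
  assumes "inj_on f A" "inj_on f B"
    and "\<And>a b. a \<in> A \<Longrightarrow> b \<in> B \<Longrightarrow> P (f a) (f b) \<longleftrightarrow> Q a b"
    and "\<exists>!q. q \<in> A \<times> B \<and> (case q of (a, b) \<Rightarrow> Q a b)"
  shows "\<exists>!q. q \<in> f ` A \<times> f ` B \<and> (case q of (a, b) \<Rightarrow> P a b)"
proof -
  obtain q where q: "q \<in> A \<times> B" "case q of (a, b) \<Rightarrow> Q a b"
    and uniq: "\<And>q'. q' \<in> A \<times> B \<and> (case q' of (a, b) \<Rightarrow> Q a b) \<Longrightarrow> q' = q"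
    using assms(4) by (elim ex1E) blast
  obtain a b where "q = (a, b)" by (cases q)
  with q have ab: "a \<in> A" "b \<in> B" "Q a b" by auto
  have u: "a' = a \<and> b' = b" if "a' \<in> A" "b' \<in> B" "Q a' b'" for a' b'
    using uniq[of "(a', b')"] that \<open>q = (a, b)\<close> by simp
  show ?thesis
  proof (rule ex1I[of _ "(f a, f b)"])
    show "(f a, f b) \<in> f ` A \<times> f ` B \<and> (case (f a, f b) of (a, b) \<Rightarrow> P a b)"
      using ab assms(3) by simp
  next
    fix q assume q: "q \<in> f ` A \<times> f ` B \<and> (case q of (a, b) \<Rightarrow> P a b)"
    then obtain a' b' where "q = (f a', f b')" "a' \<in> A" "b' \<in> B" by blast
    with q assms(3) u show "q = (f a, f b)" by auto
  qed
qed

text \<open>By \<open>sim_sym\<close> and \<open>sim_unique\<close>, \<open>\<sim>\<close> is the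
  graph of a partial involution on paths of length 2: such a path bounds at most one square. This is
  what keeps the generated congruence small on short paths.\<close>

locale square_kdigraph = wf_digraph "dgraph D" for D :: "('v, 'e) kdigraph" +
  assumes sim_ends: "((x, y), (y', x')) \<in> sim D \<Longrightarrow>
      tail (dgraph D) y' = tail (dgraph D) x \<and> tail (dgraph D) y = head (dgraph D) x \<and>
      tail (dgraph D) x' = head (dgraph D) y' \<and> head (dgraph D) x' = head (dgraph D) y"
    and sim_colour: "((x, y), (y', x')) \<in> sim D \<Longrightarrow>
      ecolour D x' = ecolour D x \<and> ecolour D y' = ecolour D y"
    and sim_sym: "(p, q) \<in> sim D \<Longrightarrow> (q, p) \<in> sim D"
    and sim_unique: "(p, q) \<in> sim D \<Longrightarrow> (q, r) \<in> sim D \<Longrightarrow> p = r"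
begin

section \<open>The congruence generated by the squares, on short paths\<close>

lemma edge_in_paths: "e \<in> arcs (dgraph D) \<Longrightarrow> (tail (dgraph D) e, [e], head (dgraph D) e) \<in> paths D"
  by (auto simp: paths_def awalk_def cas.simps)

lemma pair_in_paths:
  assumes "x \<in> arcs (dgraph D)" "y \<in> arcs (dgraph D)" "tail (dgraph D) y = head (dgraph D) x"
  shows "(tail (dgraph D) x, [x, y], head (dgraph D) y) \<in> paths D"
  using assms by (auto simp: paths_def awalk_def cas.simps)

lemma path_comp_in_paths:
  assumes "f \<in> paths D" "g \<in> paths D" "path_src g = path_rng f"
  shows "path_comp g f \<in> paths D"
  using assms by (auto simp: paths_def path_comp_def path_src_def path_rng_def)

text \<open>One induction proves all conjuncts, because they feed each other. Equal lengths and
  colour counts make the degree well defined; rigidity of paths of length at most 1 is what the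
  composition case needs in order to control paths of length 2.\<close>

lemma path_cong_invariant:
  assumes "((u, p, v), (u', q, v')) \<in> path_cong D"
  shows "(u, p, v) \<in> paths D \<and> (u', q, v') \<in> paths D \<and> u' = u \<and> v' = v \<and>
    length q = length p \<and>
    (\<forall>i. length (filter (\<lambda>e. ecolour D e = i) q) = length (filter (\<lambda>e. ecolour D e = i) p)) \<and>
    (length p \<le> 1 \<longrightarrow> q = p) \<and>
    (\<forall>x y y' x'. p = [x, y] \<and> q = [y', x'] \<longrightarrow> q = p \<or> ((x, y), (y', x')) \<in> sim D)"
  using assms
proof (induction "(u, p, v)" "(u', q, v')" arbitrary: u p v u' q v')
  case (gen x y y' x' u v)
  then show ?case using sim_colour[OF gen(1)] by auto
next
  case refl
  then show ?case by simp
next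
  case sym
  then show ?case by (auto dest: sim_sym simp: le_Suc_eq)
next
  case (trans g u p v u'' r v'')
  obtain w q w' where g: "g = (w, q, w')" by (cases g)
  note 1 = trans(2)[OF g] and 2 = trans(4)[OF g]
  \<comment> \<open>The intermediate path \<open>q\<close> has length 2 as well. If neither half of
    the chain is an equality, two squares share the path \<open>q\<close>, and
    \<open>sim_unique\<close> gives \<open>r = p\<close>.\<close>
  have "r = p \<or> ((x, y), (y', x')) \<in> sim D" if "p = [x, y]" "r = [y', x']" for x y y' x'
  proof -
    have "length q = Suc (Suc 0)" using 1 that(1) by simp
    then obtain s t where "q = [s, t]" by (auto simp: length_Suc_conv)
    then show ?thesis using 1 2 that sim_unique by fastforce
  qed
  then show ?case using 1 2 by auto
next
  case (comp f f' g g')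
  obtain a p b where f: "f = (a, p, b)" by (cases f)
  obtain a' p' b' where f': "f' = (a', p', b')" by (cases f')
  obtain c q d where g: "g = (c, q, d)" by (cases g)
  obtain c' q' d' where g': "g' = (c', q', d')" by (cases g')
  note 1 = comp(2)[OF f f'] and 2 = comp(4)[OF g g']
  have p: "path_comp g f \<in> paths D" "path_comp g' f' \<in> paths D"
    using 1 2 comp(5) unfolding f f' g g'
    by (auto intro!: path_comp_in_paths simp: path_src_def path_rng_def)
  \<comment> \<open>Two edges split either as 0 + 2, where the nonempty factor inherits the claim,
    or as 1 + 1, where both factors are unchanged.\<close>
  have "p' @ q' = p @ q \<or> ((x, y), (y', x')) \<in> sim D"
    if "p @ q = [x, y]" "p' @ q' = [y', x']" for x y y' x'
  proof -
    have "length p + length q = 2" using arg_cong[OF that(1), of length] by simp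
    then consider "p = []" | "q = []" | "length p = 1" "length q = 1"
      by (cases "length p"; cases "length q") auto
    then show ?thesis using 1 2 that by cases auto
  qed
  moreover have "p' @ q' = p @ q" if "length (p @ q) \<le> 1"
    using 1 2 that by auto
  ultimately show ?case
    using 1 2 p comp(6,7) unfolding f f' g g' by (auto simp: path_comp_def)
qed

lemma equiv_path_cong: "equiv (paths D) (path_cong D)"
proof (rule equivI)
  show "path_cong D \<subseteq> paths D \<times> paths D" by (auto dest!: path_cong_invariant)
  show "refl_on (paths D) (path_cong D)" by (auto simp: refl_on_def intro: path_cong.refl)
  show "Relation.sym (path_cong D)" by (meson symI path_cong.sym)
  show "Relation.trans (path_cong D)" by (meson transI path_cong.trans)
qed

text \<open>Ends and degree are constant on a congruence class, so each \<open>the_elem\<close> in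
  \<open>Lambda\<close> is applied to a singleton and can be read off from any
  representative.\<close>

lemma path_cong_class_ends:
  assumes "(u, p, v) \<in> paths D"
  shows "Src (Lambda D) (path_cong D `` {(u, p, v)}) = u"
    and "Rng (Lambda D) (path_cong D `` {(u, p, v)}) = v"
    and "Deg (Lambda D) (path_cong D `` {(u, p, v)}) = path_deg D (u, p, v)"
proof -
  let ?C = "path_cong D `` {(u, p, v)}"
  have C: "(u, p, v) \<in> ?C" using assms by (auto intro: path_cong.refl)
  have inv: "path_src f = u" "path_rng f = v" "path_deg D f = path_deg D (u, p, v)"
    if "f \<in> ?C" for f
    using that by (cases f; auto dest!: path_cong_invariant simp: path_src_def path_rng_def path_deg_def)+
  show "Src (Lambda D) ?C = u"
    unfolding Lambda_def using image_eq_singleton[OF C inv(1)] by simp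
  show "Rng (Lambda D) ?C = v"
    unfolding Lambda_def using image_eq_singleton[OF C inv(2)] by simp
  show "Deg (Lambda D) ?C = path_deg D (u, p, v)"
    unfolding Lambda_def using image_eq_singleton[OF C inv(3)] by simp
qed

section \<open>Edges as the morphisms of degree a unit vector\<close>

definition edge_class :: "'e \<Rightarrow> ('v, 'e) path set" where
  "edge_class e = {(tail (dgraph D) e, [e], head (dgraph D) e)}"

lemma inj_edge_class: "inj_on edge_class S"
  by (auto simp: inj_on_def edge_class_def)

text \<open>A path of length 1 is congruent only to itself, so the singleton
  \<open>edge_class e\<close> is the full class. Writing it as a singleton makes injectivity and the
  formula for composites immediate.\<close>

lemma edge_class_eq:
  assumes "e \<in> arcs (dgraph D)"
  shows "path_cong D `` {(tail (dgraph D) e, [e], head (dgraph D) e)} = edge_class e"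
  using edge_in_paths[OF assms]
  by (auto simp: edge_class_def dest!: path_cong_invariant intro: path_cong.refl)

lemma edge_class_ends:
  assumes "e \<in> arcs (dgraph D)"
  shows "Src (Lambda D) (edge_class e) = tail (dgraph D) e"
    and "Rng (Lambda D) (edge_class e) = head (dgraph D) e"
    and "Deg (Lambda D) (edge_class e) = unit_deg (ecolour D e)"
  using path_cong_class_ends[OF edge_in_paths[OF assms]]
  by (auto simp: edge_class_eq[OF assms] path_deg_def unit_deg_def)

text \<open>The total degree of a path is its number of edges, so a path whose degree is a unit
  vector is a single edge of that colour.\<close>

lemma alphabet_Lambda: "alphabet (Lambda D) i = edge_class ` colour_arcs D i"
proof (intro equalityI subsetI)
  fix f assume f: "f \<in> alphabet (Lambda D) i"
  then obtain u p v where p: "(u, p, v) \<in> paths D" "f = path_cong D `` {(u, p, v)}"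
    by (auto simp: alphabet_def Lambda_def elim!: quotientE)
  then have d: "path_deg D (u, p, v) = unit_deg i"
    using f path_cong_class_ends(3) by (auto simp: alphabet_def)
  have deg: "length (filter (\<lambda>e. ecolour D e = j) p) = (if j = i then 1 else 0)" for j
    using fun_cong[OF d, of j] by (simp add: path_deg_def unit_deg_def)
  \<comment> \<open>The edge \<open>e\<close> is itself counted in the colour
    \<open>ecolour D e\<close>, so that count is not 0.\<close>
  have "ecolour D e = i" if "e \<in> set p" for e
    using deg[of "ecolour D e"] that by (auto simp: filter_empty_conv split: if_splits)
  moreover from this have "length p = 1"
    using deg[of i] by (simp add: filter_True)
  ultimately obtain e where e: "p = [e]" "ecolour D e = i"
    by (auto simp: length_Suc_conv)
  then have "e \<in> arcs (dgraph D)" "u = tail (dgraph D) e" "v = head (dgraph D) e"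
    using p(1) by (auto simp: paths_def awalk_def cas.simps)
  then show "f \<in> edge_class ` colour_arcs D i"
    using e p(2) edge_class_eq by (auto simp: colour_arcs_def)
next
  fix f assume "f \<in> edge_class ` colour_arcs D i"
  then obtain e where e: "f = edge_class e" "e \<in> arcs (dgraph D)" "ecolour D e = i"
    by (auto simp: colour_arcs_def)
  moreover have "f \<in> Mor (Lambda D)"
    using e edge_class_eq quotientI[OF edge_in_paths[OF e(2)], of "path_cong D"]
    by (simp add: Lambda_def)
  ultimately show "f \<in> alphabet (Lambda D) i"
    by (simp add: alphabet_def edge_class_ends)
qed

text \<open>The unions in \<open>Comp\<close> run over singletons here. Composability is not asked
  for, as \<open>path_comp\<close> merely concatenates; it is part of
  \<open>commuting_square\<close>.\<close>

lemma Comp_edge_class: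
  "Comp (Lambda D) (edge_class y) (edge_class x) =
     path_cong D `` {(tail (dgraph D) x, [x, y], head (dgraph D) y)}"
  by (simp add: Lambda_def edge_class_def path_comp_def)

text \<open>Equal composites mean congruent paths of length 2, which are equal or bound a square;
  \<open>x \<noteq> y\<close> rules out equality.\<close>

lemma commuting_square_edge_class:
  assumes "x \<in> arcs (dgraph D)" "y' \<in> arcs (dgraph D)" "y \<in> arcs (dgraph D)" "x' \<in> arcs (dgraph D)"
    and "x \<noteq> y"
  shows "commuting_square (Lambda D) (edge_class x) (edge_class y') (edge_class y) (edge_class x')
     \<longleftrightarrow> ((x, y'), (y, x')) \<in> sim D" (is "?L \<longleftrightarrow> ?R")
proof
  assume L: ?L
  then have t: "tail (dgraph D) y' = head (dgraph D) x" "tail (dgraph D) x' = head (dgraph D) y"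
    using assms by (auto simp: commuting_square_def edge_class_ends)
  have "((tail (dgraph D) x, [x, y'], head (dgraph D) y'),
      (tail (dgraph D) y, [y, x'], head (dgraph D) x')) \<in> path_cong D"
    using L eq_equiv_class_iff[OF equiv_path_cong pair_in_paths pair_in_paths] assms t
    by (simp add: commuting_square_def Comp_edge_class)
  from path_cong_invariant[OF this] show ?R using assms(5) by auto
next
  assume R: ?R
  note e = sim_ends[OF R]
  have "((tail (dgraph D) x, [x, y'], head (dgraph D) y'),
      (tail (dgraph D) x, [y, x'], head (dgraph D) y')) \<in> path_cong D"
    using path_cong.gen[OF R] e pair_in_paths[of x y'] pair_in_paths[of y x'] assms by auto
  then have "Comp (Lambda D) (edge_class y') (edge_class x) =
      Comp (Lambda D) (edge_class x') (edge_class y)"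
    using e by (simp add: Comp_edge_class equiv_class_eq[OF equiv_path_cong])
  then show ?L
    using e assms by (simp add: commuting_square_def edge_class_ends)
qed

section \<open>Transfer of rigidity and connectedness to the \<open>k\<close>-graph\<close>

lemma kgraph_right_rigid_Lambda:
  assumes "DG_right_rigid k D"
  shows "kgraph_right_rigid k (Lambda D)"
  unfolding kgraph_right_rigid_def alphabet_Lambda
proof (intro allI impI ballI)
  fix i j f g
  assume ij: "i < k" "j < k" "i \<noteq> j"
    and f: "f \<in> edge_class ` colour_arcs D i" and g: "g \<in> edge_class ` colour_arcs D j"
    and s: "Src (Lambda D) f = Src (Lambda D) g"
  obtain x y where xy: "x \<in> colour_arcs D i" "f = edge_class x"
    "y \<in> colour_arcs D j" "g = edge_class y" using f g by blast
  then have "tail (dgraph D) x = tail (dgraph D) y"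
    using s by (auto simp: edge_class_ends colour_arcs_def)
  then have "\<exists>!q. q \<in> colour_arcs D i \<times> colour_arcs D j \<and>
      (case q of (x', y') \<Rightarrow> ((x, y'), (y, x')) \<in> sim D)"
    using assms ij xy unfolding DG_right_rigid_def by blast
  then show "\<exists>!q. q \<in> edge_class ` colour_arcs D i \<times> edge_class ` colour_arcs D j \<and>
      (case q of (x', y') \<Rightarrow> commuting_square (Lambda D) f y' g x')"
    unfolding xy(2,4)
  proof (rule ex1_pair_image[OF inj_edge_class inj_edge_class, rotated])
    fix x' y' assume "x' \<in> colour_arcs D i" "y' \<in> colour_arcs D j"
    then show "commuting_square (Lambda D) (edge_class x) (edge_class y') (edge_class y)
        (edge_class x') \<longleftrightarrow> ((x, y'), (y, x')) \<in> sim D"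
      \<comment> \<open>The edges \<open>x\<close> and \<open>y\<close> have different colours,
        hence \<open>x \<noteq> y\<close>.\<close>
      using xy ij by (intro commuting_square_edge_class) (auto simp: colour_arcs_def)
  qed
qed

lemma kgraph_left_rigid_Lambda:
  assumes "DG_left_rigid k D"
  shows "kgraph_left_rigid k (Lambda D)"
  unfolding kgraph_left_rigid_def alphabet_Lambda
proof (intro allI impI ballI)
  fix i j f g
  assume ij: "i < k" "j < k" "i \<noteq> j"
    and f: "f \<in> edge_class ` colour_arcs D i" and g: "g \<in> edge_class ` colour_arcs D j"
    and s: "Rng (Lambda D) f = Rng (Lambda D) g"
  obtain x' y' where xy: "x' \<in> colour_arcs D i" "f = edge_class x'"
    "y' \<in> colour_arcs D j" "g = edge_class y'" using f g by blast
  then have "head (dgraph D) x' = head (dgraph D) y'"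
    using s by (auto simp: edge_class_ends colour_arcs_def)
  then have "\<exists>!q. q \<in> colour_arcs D i \<times> colour_arcs D j \<and>
      (case q of (x, y) \<Rightarrow> ((x, y'), (y, x')) \<in> sim D)"
    using assms ij xy unfolding DG_left_rigid_def by blast
  then show "\<exists>!q. q \<in> edge_class ` colour_arcs D i \<times> edge_class ` colour_arcs D j \<and>
      (case q of (x, y) \<Rightarrow> commuting_square (Lambda D) x g y f)"
    unfolding xy(2,4)
  proof (rule ex1_pair_image[OF inj_edge_class inj_edge_class, rotated])
    fix x y assume "x \<in> colour_arcs D i" "y \<in> colour_arcs D j"
    then show "commuting_square (Lambda D) (edge_class x) (edge_class y') (edge_class y)
        (edge_class x') \<longleftrightarrow> ((x, y'), (y, x')) \<in> sim D"
      \<comment> \<open>Again \<open>x \<noteq> y\<close> because the colours differ.\<close>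
      using xy ij by (intro commuting_square_edge_class) (auto simp: colour_arcs_def)
  qed
qed

lemma kgraph_strongly_connected_Lambda:
  assumes "\<And>v w. v \<in> verts (dgraph D) \<Longrightarrow> w \<in> verts (dgraph D) \<Longrightarrow> \<exists>p. awalk v p w"
  shows "kgraph_strongly_connected (Lambda D)"
  unfolding kgraph_strongly_connected_def
proof (intro ballI)
  fix v w assume "v \<in> Obj (Lambda D)" "w \<in> Obj (Lambda D)"
  \<comment> \<open>Range \<open>v\<close> and source \<open>w\<close> call for a walk from
    \<open>w\<close> to \<open>v\<close>.\<close>
  then obtain p where "awalk w p v" using assms by (auto simp: Lambda_def)
  then have p: "(w, p, v) \<in> paths D" by (simp add: paths_def)
  then have "path_cong D `` {(w, p, v)} \<in> Mor (Lambda D)"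
    by (simp add: Lambda_def quotientI)
  then show "\<exists>f \<in> Mor (Lambda D). Rng (Lambda D) f = v \<and> Src (Lambda D) f = w"
    using path_cong_class_ends[OF p] by blast
qed

end

section \<open>The digraph of a cover\<close>

text \<open>Multiplication maps \<open>S \<times> T\<close> onto \<open>S <#> T\<close>; a
  surjection between finite sets of equal size is injective.\<close>

lemma (in group) set_mult_factor_unique:
  assumes "finite S" "finite T" "card (S <#> T) = card S * card T"
    and "a \<in> S" "a' \<in> S" "b \<in> T" "b' \<in> T" "a \<otimes> b = a' \<otimes> b'"
  shows "a = a' \<and> b = b'"
proof -
  have "S <#> T = (\<lambda>(a, b). a \<otimes> b) ` (S \<times> T)" by (auto simp: set_mult_def)
  then have "inj_on (\<lambda>(a, b). a \<otimes> b) (S \<times> T)"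
    using assms by (intro eq_card_imp_inj_on) (auto simp: card_cartesian_product)
  then show ?thesis using assms unfolding inj_on_def by fastforce
qed

locale cube_cover = normal H G for H and G (structure) +
  fixes k :: nat and A :: "nat \<Rightarrow> 'a set"
  assumes A_finite: "i < k \<Longrightarrow> finite (A i)"
    and A_carrier: "i < k \<Longrightarrow> A i \<subseteq> carrier G"
    and A_inv: "i < k \<Longrightarrow> a \<in> A i \<Longrightarrow> inv a \<in> A i"
    and A_generate: "generate G (\<Union>i<k. A i) = carrier G"
    and A_card: "i < k \<Longrightarrow> j < k \<Longrightarrow> i \<noteq> j \<Longrightarrow> card (A i <#> A j) = card (A i) * card (A j)"
    and A_commute: "i < k \<Longrightarrow> j < k \<Longrightarrow> i \<noteq> j \<Longrightarrow> A i <#> A j = A j <#> A i"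
begin

section \<open>Factorisations in \<open>G\<close> and its right action on the vertices\<close>

definition X :: "('a set, 'a set \<times> nat \<times> 'a) square_complex" where
  "X = covering_complex G H (one_vertex_complex G k A)"

text \<open>The terminus of the lift at \<open>v\<close> of a loop labelled \<open>a\<close>. The
  lemmas below show that this is a transitive right action of \<open>G\<close> on
  \<open>G/H\<close>.\<close>

definition translate :: "'a set \<Rightarrow> 'a \<Rightarrow> 'a set" where
  "translate v a = v \<otimes>\<^bsub>G Mod H\<^esub> (H #> a)"

lemma A_in_carrier: "i < k \<Longrightarrow> a \<in> A i \<Longrightarrow> a \<in> carrier G"
  using A_carrier by blast

lemma factor_unique:
  assumes "i < k" "j < k" "i \<noteq> j" "a \<in> A i" "a' \<in> A i" "b \<in> A j" "b' \<in> A j" "a \<otimes> b = a' \<otimes> b'"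
  shows "a = a' \<and> b = b'"
  using set_mult_factor_unique A_finite A_card assms by metis

lemma factor_swap:
  assumes "i < k" "j < k" "i \<noteq> j" "a \<in> A i" "b \<in> A j"
  obtains a' b' where "a' \<in> A i" "b' \<in> A j" "a \<otimes> b = b' \<otimes> a'"
proof -
  have "a \<otimes> b \<in> A i <#> A j" using assms by (auto simp: set_mult_def)
  then have "a \<otimes> b \<in> A j <#> A i" using A_commute assms by blast
  then show ?thesis using that by (auto simp: set_mult_def)
qed

lemma translate_closed:
  assumes "v \<in> carrier (G Mod H)" "a \<in> carrier G"
  shows "translate v a \<in> carrier (G Mod H)"
  unfolding translate_def
  \<comment> \<open>The last two premises only name the complexes, so reflexivity discharges
    them.\<close>
  by (rule coset_translate(1)[OF group_axioms _ normal_axioms HOL.refl HOL.refl])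
    (use assms A_carrier in auto)

lemma translate_translate:
  assumes "v \<in> carrier (G Mod H)" "a \<in> carrier G" "b \<in> carrier G"
  shows "translate (translate v a) b = translate v (a \<otimes> b)"
  unfolding translate_def
  by (rule coset_translate(2)[OF group_axioms _ normal_axioms HOL.refl HOL.refl])
    (use assms A_carrier in auto)

lemma translate_one:
  assumes "v \<in> carrier (G Mod H)"
  shows "translate v \<one> = v"
proof -
  interpret Q: group "G Mod H" by (rule factorgroup_is_group)
  have "H #> \<one> = \<one>\<^bsub>G Mod H\<^esub>" by (simp add: FactGroup_def coset_mult_one subset)
  then show ?thesis using assms Q.r_one unfolding translate_def by simp
qed

lemma translate_transitive:
  assumes "v \<in> carrier (G Mod H)" "w \<in> carrier (G Mod H)"
  obtains g where "g \<in> carrier G" "w = translate v g"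
proof -
  interpret Q: group "G Mod H" by (rule factorgroup_is_group)
  \<comment> \<open>The element sought is any representative of the coset \<open>v\<close>-inverse
    times \<open>w\<close>.\<close>
  have "inv\<^bsub>G Mod H\<^esub> v \<otimes>\<^bsub>G Mod H\<^esub> w \<in> carrier (G Mod H)"
    using assms by (intro Q.m_closed Q.inv_closed)
  then obtain g where g: "g \<in> carrier G" "inv\<^bsub>G Mod H\<^esub> v \<otimes>\<^bsub>G Mod H\<^esub> w = H #> g"
    by (auto simp: FactGroup_def RCOSETS_def)
  have "w = v \<otimes>\<^bsub>G Mod H\<^esub> (inv\<^bsub>G Mod H\<^esub> v \<otimes>\<^bsub>G Mod H\<^esub> w)"
    using Q.m_assoc[symmetric, of v "inv\<^bsub>G Mod H\<^esub> v" w] assms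
      Q.r_inv[of v] Q.l_one[of w] Q.inv_closed[of v] by metis
  with g show ?thesis using that by (simp add: translate_def)
qed

section \<open>The digraph of the cover in coordinates\<close>

lemma verts_DG: "verts (dgraph (DG X)) = carrier (G Mod H)"
  by (simp add: DG_def X_def covering_complex_def Let_def)

lemma arcs_DG: "(v, i, a) \<in> arcs (dgraph (DG X)) \<longleftrightarrow> v \<in> carrier (G Mod H) \<and> i < k \<and> a \<in> A i"
  by (auto simp: DG_def X_def covering_complex_def Let_def one_vertex_complex_def)

lemma tail_DG: "tail (dgraph (DG X)) (v, i, a) = v"
  by (simp add: DG_def X_def covering_complex_def Let_def)

lemma head_DG: "head (dgraph (DG X)) (v, i, a) = translate v a"
  by (simp add: DG_def X_def covering_complex_def Let_def translate_def)

lemma ecolour_DG: "ecolour (DG X) (v, i, a) = i"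
  by (simp add: DG_def X_def covering_complex_def Let_def one_vertex_complex_def)

lemma colour_arcs_DG:
  "i < k \<Longrightarrow> colour_arcs (DG X) i = {(v, i, a) | v a. v \<in> carrier (G Mod H) \<and> a \<in> A i}"
  by (auto simp: colour_arcs_def arcs_DG ecolour_DG)

text \<open>The right side omits that both boundary paths end at the same vertex: this follows from
  \<open>a \<otimes> b = b' \<otimes> a'\<close>, since \<open>translate\<close> is a right action.
  A square is thus given by its first corner \<open>v\<close> and its labels.\<close>

lemma sim_DG:
  "(((v, i, a), (w, j, b)), ((v', j', b'), (w', i', a'))) \<in> sim (DG X) \<longleftrightarrow>
     v \<in> carrier (G Mod H) \<and> i < k \<and> j < k \<and> i \<noteq> j \<and> i' = i \<and> j' = j \<and>
     a \<in> A i \<and> a' \<in> A i \<and> b \<in> A j \<and> b' \<in> A j \<and> a \<otimes> b = b' \<otimes> a' \<and>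
     v' = v \<and> w = translate v a \<and> w' = translate v b'" (is "?L \<longleftrightarrow> ?R")
proof
  assume ?L
  then show ?R
    by (auto simp: DG_def X_def covering_complex_def Let_def one_vertex_complex_def translate_def)
next
  assume R: ?R
  then have "a \<in> carrier G" "a' \<in> carrier G" "b \<in> carrier G" "b' \<in> carrier G"
    using A_in_carrier by blast+
  with R have "translate v a \<in> carrier (G Mod H)" "translate v b' \<in> carrier (G Mod H)"
    "translate (translate v b') a' = translate (translate v a) b"
    by (simp_all add: translate_closed translate_translate)
  with R show ?L
    by (auto simp: DG_def X_def covering_complex_def Let_def one_vertex_complex_def
        translate_def[symmetric] simp del: mult_FactGroup)
qed

text \<open>Unique factorisation yields \<open>sim_unique\<close>: if \<open>ab = b'a'\<close> and
  \<open>b'a' = a''b''\<close>, then \<open>a = a''\<close> and \<open>b = b''\<close>, and the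
  vertices are determined by \<open>v\<close> and the labels.\<close>

sublocale square_kdigraph "DG X"
proof
  fix e assume e: "e \<in> arcs (dgraph (DG X))"
  obtain v i a where "e = (v, i, a)" by (cases e)
  with e show "tail (dgraph (DG X)) e \<in> verts (dgraph (DG X))"
    "head (dgraph (DG X)) e \<in> verts (dgraph (DG X))"
    using translate_closed A_in_carrier by (auto simp: arcs_DG verts_DG tail_DG head_DG)
next
  fix x y y' x' assume *: "((x, y), (y', x')) \<in> sim (DG X)"
  obtain v i a where x: "x = (v, i, a)" by (cases x)
  obtain w j b where y: "y = (w, j, b)" by (cases y)
  obtain v' j' b' where y': "y' = (v', j', b')" by (cases y')
  obtain w' i' a' where x': "x' = (w', i', a')" by (cases x')
  note s = *[unfolded x y y' x' sim_DG]
  then have car: "a \<in> carrier G" "a' \<in> carrier G" "b \<in> carrier G" "b' \<in> carrier G"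
    using A_in_carrier by blast+
  show "tail (dgraph (DG X)) y' = tail (dgraph (DG X)) x \<and>
      tail (dgraph (DG X)) y = head (dgraph (DG X)) x \<and>
      tail (dgraph (DG X)) x' = head (dgraph (DG X)) y' \<and>
      head (dgraph (DG X)) x' = head (dgraph (DG X)) y"
    using s car by (auto simp: x y y' x' tail_DG head_DG translate_translate)
  show "ecolour (DG X) x' = ecolour (DG X) x \<and> ecolour (DG X) y' = ecolour (DG X) y"
    using s by (auto simp: x y y' x' ecolour_DG)
next
  fix p q :: "('a set \<times> nat \<times> 'a) \<times> ('a set \<times> nat \<times> 'a)"
  assume "(p, q) \<in> sim (DG X)"
  then show "(q, p) \<in> sim (DG X)"
    by (cases p; cases q) (auto simp: sim_DG)
next
  fix p q r :: "('a set \<times> nat \<times> 'a) \<times> ('a set \<times> nat \<times> 'a)"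
  assume "(p, q) \<in> sim (DG X)" "(q, r) \<in> sim (DG X)"
  then show "p = r"
    by (cases p; cases q; cases r) (auto simp: sim_DG dest: factor_unique)
qed

section \<open>Rigidity of the digraph of the cover\<close>

lemma DG_right_rigid_cover: "DG_right_rigid k (DG X)"
  unfolding DG_right_rigid_def
proof (intro allI impI ballI)
  fix i j x y
  assume ij: "i < k" "j < k" "i \<noteq> j"
    and "x \<in> colour_arcs (DG X) i" "y \<in> colour_arcs (DG X) j"
    and "tail (dgraph (DG X)) x = tail (dgraph (DG X)) y"
  then obtain v a b where x: "x = (v, i, a)" and y: "y = (v, j, b)"
    and v: "v \<in> carrier (G Mod H)" and ab: "a \<in> A i" "b \<in> A j"
    by (auto simp: colour_arcs_DG tail_DG)
  note car = A_in_carrier[OF ij(1)] A_in_carrier[OF ij(2)]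
  \<comment> \<open>The unknown labels \<open>a'\<close> and \<open>b'\<close> in
    \<open>ab' = ba'\<close> are the factors of
    \<open>inv b \<otimes> a = a' \<otimes> inv b'\<close>; so \<open>c\<close> is the inverse of
    the label of \<open>y'\<close>.\<close>
  obtain a' c where c: "a' \<in> A i" "c \<in> A j" "inv b \<otimes> a = a' \<otimes> c"
    using factor_swap[OF ij(2,1)] ij ab A_inv by metis
  have eq: "a \<otimes> inv c = b \<otimes> a'"
    using c ab car by (metis inv_solve_left inv_solve_right inv_closed m_assoc m_closed)
  have uniq: "a'' = a' \<and> b'' = inv c"
    if "a'' \<in> A i" "b'' \<in> A j" "a \<otimes> b'' = b \<otimes> a''" for a'' b''
  proof -
    have "a'' \<otimes> inv b'' = inv b \<otimes> a"
      using that ab car by (metis inv_solve_left inv_solve_right inv_closed m_assoc m_closed)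
    then have "a'' = a' \<and> inv b'' = c"
      using factor_unique[OF ij that(1) c(1) A_inv[OF ij(2) that(2)] c(2)] c(3) by simp
    then show ?thesis using that car by auto
  qed
  show "\<exists>!q. q \<in> colour_arcs (DG X) i \<times> colour_arcs (DG X) j \<and>
      (case q of (x', y') \<Rightarrow> ((x, y'), (y, x')) \<in> sim (DG X))"
  \<comment> \<open>The starting vertices are forced: \<open>x'\<close> begins where
    \<open>y\<close> ends, and \<open>y'\<close> begins where \<open>x\<close> ends.\<close>
  proof (rule ex1I[of _ "((translate v b, i, a'), (translate v a, j, inv c))"])
    show "((translate v b, i, a'), (translate v a, j, inv c)) \<in>
        colour_arcs (DG X) i \<times> colour_arcs (DG X) j \<and>
      (case ((translate v b, i, a'), (translate v a, j, inv c)) of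
        (x', y') \<Rightarrow> ((x, y'), (y, x')) \<in> sim (DG X))"
      using ij v ab c eq car A_inv translate_closed by (auto simp: x y sim_DG colour_arcs_DG)
  next
    fix q
    assume "q \<in> colour_arcs (DG X) i \<times> colour_arcs (DG X) j \<and>
      (case q of (x', y') \<Rightarrow> ((x, y'), (y, x')) \<in> sim (DG X))"
    then show "q = ((translate v b, i, a'), (translate v a, j, inv c))"
      using ij uniq by (auto simp: x y sim_DG colour_arcs_DG)
  qed
qed

lemma DG_left_rigid_cover: "DG_left_rigid k (DG X)"
  unfolding DG_left_rigid_def
proof (intro allI impI ballI)
  fix i j x' y'
  assume ij: "i < k" "j < k" "i \<noteq> j"
    and "x' \<in> colour_arcs (DG X) i" "y' \<in> colour_arcs (DG X) j"
    and h: "head (dgraph (DG X)) x' = head (dgraph (DG X)) y'"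
  then obtain w v a' b' where x': "x' = (w, i, a')" and y': "y' = (v, j, b')"
    and v: "v \<in> carrier (G Mod H)" and w: "w \<in> carrier (G Mod H)"
    and ab: "a' \<in> A i" "b' \<in> A j"
    by (auto simp: colour_arcs_DG)
  note car = A_in_carrier[OF ij(1)] A_in_carrier[OF ij(2)]
  \<comment> \<open>Here \<open>ab' = ba'\<close> is to be solved for \<open>a\<close> and
    \<open>b\<close>, in the form \<open>a' \<otimes> inv b' = inv b \<otimes> a\<close>; so
    \<open>c\<close> is the inverse of the label of \<open>y\<close>.\<close>
  obtain a c where c: "a \<in> A i" "c \<in> A j" "a' \<otimes> inv b' = c \<otimes> a"
    using factor_swap[OF ij ab(1)] ij ab A_inv by metis
  \<comment> \<open>The common origin of \<open>x\<close> and \<open>y\<close> also has to be found.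
    It is the only vertex at which an edge labelled \<open>a\<close> leads to \<open>v\<close>, the
    origin of \<open>y'\<close>.\<close>
  let ?u = "translate v (inv a)"
  have cr: "a \<in> carrier G" "c \<in> carrier G" "a' \<in> carrier G" "b' \<in> carrier G"
    using c ab car by auto
  have eq: "a \<otimes> b' = inv c \<otimes> a'"
    using c(3) cr by (metis inv_solve_left inv_solve_right inv_closed m_assoc m_closed)
  have u: "?u \<in> carrier (G Mod H)" using v cr translate_closed by simp
  have ua: "translate ?u a = v" using v cr by (simp add: translate_translate translate_one)
  \<comment> \<open>That the other side of the square reaches the origin \<open>w\<close> of
    \<open>x'\<close> uses the common terminus: \<open>w\<close> is \<open>v\<close> translated by
    \<open>b' \<otimes> inv a' = inv a \<otimes> inv c\<close>.\<close>
  have uc: "translate ?u (inv c) = w"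
  proof -
    have "translate w a' = translate v b'" using h by (simp add: x' y' head_DG)
    then have "w = translate (translate v b') (inv a')"
      using w cr by (metis inv_closed r_inv translate_one translate_translate)
    moreover have "inv a \<otimes> inv c = b' \<otimes> inv a'"
      using eq cr by (metis inv_solve_left inv_solve_right inv_closed m_assoc m_closed)
    ultimately show ?thesis using v cr by (simp add: translate_translate)
  qed
  have uniq: "a'' = a \<and> b'' = inv c"
    if "a'' \<in> A i" "b'' \<in> A j" "a'' \<otimes> b' = b'' \<otimes> a'" for a'' b''
  proof -
    have "inv b'' \<otimes> a'' = a' \<otimes> inv b'"
      using that ab car by (metis inv_solve_left inv_solve_right inv_closed m_assoc m_closed)
    then have "inv b'' = c \<and> a'' = a"
      using factor_unique[OF ij(2,1) _ A_inv[OF ij(2) that(2)] c(2) that(1) c(1)] ij c(3) by simp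
    then show ?thesis using that car by auto
  qed
  show "\<exists>!q. q \<in> colour_arcs (DG X) i \<times> colour_arcs (DG X) j \<and>
      (case q of (x, y) \<Rightarrow> ((x, y'), (y, x')) \<in> sim (DG X))"
  proof (rule ex1I[of _ "((?u, i, a), (?u, j, inv c))"])
    show "((?u, i, a), (?u, j, inv c)) \<in> colour_arcs (DG X) i \<times> colour_arcs (DG X) j \<and>
      (case ((?u, i, a), (?u, j, inv c)) of (x, y) \<Rightarrow> ((x, y'), (y, x')) \<in> sim (DG X))"
      using ij u ua uc ab c eq A_inv by (auto simp: x' y' sim_DG colour_arcs_DG)
  next
    fix q
    assume q: "q \<in> colour_arcs (DG X) i \<times> colour_arcs (DG X) j \<and>
      (case q of (x, y) \<Rightarrow> ((x, y'), (y, x')) \<in> sim (DG X))"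
    then obtain z a'' z' b'' where qz: "q = ((z, i, a''), (z', j, b''))"
      using ij by (auto simp: colour_arcs_DG)
    have s: "(((z, i, a''), (v, j, b')), ((z', j, b''), (w, i, a'))) \<in> sim (DG X)"
      using q by (simp add: qz x' y')
    then have z: "z \<in> carrier (G Mod H)" "a'' \<in> A i" "b'' \<in> A j" "a'' \<otimes> b' = b'' \<otimes> a'"
      "z' = z" "v = translate z a''"
      unfolding sim_DG by blast+
    have "a'' = a" "b'' = inv c" using uniq[OF z(2-4)] by auto
    \<comment> \<open>The origin is recovered by translating \<open>v = translate z a\<close> back
      by \<open>inv a\<close>.\<close>
    moreover have "z = ?u" using z(1,6) cr \<open>a'' = a\<close>
      by (simp add: translate_translate translate_one)
    ultimately show "q = ((?u, i, a), (?u, j, inv c))" using qz z(5) by simp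
  qed
qed

section \<open>Strong connectedness\<close>

lemma awalk_translate:
  assumes "g \<in> generate G (\<Union>i<k. A i)" "v \<in> carrier (G Mod H)"
  shows "\<exists>p. awalk v p (translate v g)"
  using assms
proof (induction arbitrary: v rule: generate.induct)
  case one
  then have "awalk v [] (translate v \<one>)" by (simp add: translate_one awalk_def cas.simps verts_DG)
  then show ?case ..
next
  case (incl a)
  then obtain i where i: "i < k" "a \<in> A i" by blast
  then have "(v, i, a) \<in> arcs (dgraph (DG X))" using incl by (simp add: arcs_DG)
  then have "awalk v [(v, i, a)] (translate v a)"
    using arc_implies_awalk by (metis tail_DG head_DG)
  then show ?case ..
next
  case (inv a)
  \<comment> \<open>Each \<open>A i\<close> is closed under inverses, so an inverse generator also
    labels an edge and no edge has to be traversed backwards.\<close>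
  then obtain i where i: "i < k" "inv a \<in> A i" using A_inv by blast
  then have "(v, i, inv a) \<in> arcs (dgraph (DG X))" using inv by (simp add: arcs_DG)
  then have "awalk v [(v, i, inv a)] (translate v (inv a))"
    using arc_implies_awalk by (metis tail_DG head_DG)
  then show ?case ..
next
  case (eng g h)
  then have "g \<in> carrier G" "h \<in> carrier G" by (simp_all add: A_generate)
  moreover obtain p where p: "awalk v p (translate v g)" using eng by blast
  moreover obtain q where "awalk (translate v g) q (translate (translate v g) h)"
    using eng.IH(2) eng.prems calculation translate_closed by blast
  ultimately show ?case using eng.prems by (metis awalk_appendI translate_translate)
qed

text \<open>Some \<open>g\<close> in \<open>G\<close> translates \<open>v\<close> to
  \<open>w\<close>; writing \<open>g\<close> as a word in the generators \<open>A i\<close> spells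
  out a directed walk.\<close>

lemma kgraph_strongly_connected_cover: "kgraph_strongly_connected (Lambda (DG X))"
proof (rule kgraph_strongly_connected_Lambda)
  fix v w assume "v \<in> verts (dgraph (DG X))" "w \<in> verts (dgraph (DG X))"
  then show "\<exists>p. awalk v p w"
    using translate_transitive awalk_translate A_generate by (metis verts_DG)
qed

end

theorem theorem4p7:
  fixes G :: "('g, 'z) monoid_scheme"
    and A :: "nat \<Rightarrow> 'g set"
    and V :: "nat \<Rightarrow> 'v set"
    and E :: "nat \<Rightarrow> 'v rel"
    and \<phi> :: "'g \<Rightarrow> (nat \<Rightarrow> 'v) \<Rightarrow> (nat \<Rightarrow> 'v)"
    and H :: "'g set"
    and k N :: nat
    and P :: "(unit, nat \<times> 'g) square_complex"
    and X :: "('g set, 'g set \<times> nat \<times> 'g) square_complex"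
  assumes "k \<ge> 2" and "N \<ge> 2"
    and "k_cube_structure G k A V E \<phi>"
    and "residually_finite G"
    and "P = one_vertex_complex G k A"
    and "H \<lhd> G" and "card (carrier (G Mod H)) = N"
    and "X = covering_complex G H P"
  shows "(DG_left_rigid k (DG X) \<and> DG_right_rigid k (DG X)) \<and>
         (kgraph_strongly_connected (Lambda (DG X)) \<and>
          kgraph_left_rigid k (Lambda (DG X)) \<and>
          kgraph_right_rigid k (Lambda (DG X)))"
proof -
  interpret normal H G by fact
  interpret cube_cover H G k A
    by unfold_locales (use assms(3) in \<open>auto simp: k_cube_structure_def\<close>)
  have "X = cube_cover.X H G k A" using assms by (simp add: X_def)
  then show ?thesis
    using DG_left_rigid_cover DG_right_rigid_cover kgraph_strongly_connected_cover
      kgraph_left_rigid_Lambda kgraph_right_rigid_Lambda by simp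
qed

end
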